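(* Let $G$ be a graph of order $n$. Then $\dim_2(G)=n-2$ if and only if $G$ or $\overline{G}$ is one of the graphs $P_4$, $K_{s,t}$ ($s,t\geq 1$), $K_s\vee\overline{K}_t$ ($s\geq 1$, $t\geq 2$), or $K_s\vee(K_t\cup K_1)$ ($s,t\geq 1$).
   Context: All graphs are finite and simple (not necessarily connected); the order of a graph is its number of vertices. $\overline{G}$ denotes the complement of $G$, $P_4$ the path on $4$ vertices, $K_s$ the complete graph on $s$ vertices, and $K_{s,t}$ the complete bipartite graph with parts of sizes $s$ and $t$. For graphs $G,H$ with disjoint vertex sets, $G\cup H$ is their disjoint union, and the join $G\vee H$ is obtained from $G\cup H$ by adding all edges $uv$ with $u\in V(G)$, $v\in V(H)$. For a graph $G$ and vertices $x,y\in V(G)$, put $a_G(x,y)=0$ if $x=y$, $a_G(x,y)=1$ if $x$ and $y$ are adjacent, and $a_G(x,y)=2$ otherwise. For a set $W=\{w_1,\ldots,w_k\}\subseteq V(G)$ and a vertex $v\in V(G)$, the adjacency representation of $v$ with respect to $W$ is the $k$-vector $r_2(v|W)=(a_G(v,w_1),\ldots,a_G(v,w_k))$. The set $W$ is an adjacency resolving set for $G$ if the vectors $r_2(v|W)$, $v\in V(G)$, are pairwise distinct. The adjacency dimension $\dim_2(G)$ is the minimum cardinality of an adjacency resolving set for $G$.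
   Formalization: Graphs of order n = 2 are excluded: K_2 = K_{1,1} and its complement satisfy the right-hand side, but their adjacency dimension is 1, not n-2 = 0, so the equivalence fails for exactly these graphs. *)

theory Defs
  imports "Graph_Theory.Graph_Theory"
begin

text \<open>
  Finite simple graphs are the pair_graph digraphs of Graph_Theory: finite, loop-free, and with a
  symmetric set of vertex pairs as arcs, so that u and v are adjacent iff (u, v) is an arc.
\<close>

definition graph_complement :: "'a pair_pre_digraph \<Rightarrow> 'a pair_pre_digraph" where
  "graph_complement G = \<lparr> pverts = pverts G,
     parcs = {(u, v). u \<in> pverts G \<and> v \<in> pverts G \<and> u \<noteq> v \<and> (u, v) \<notin> parcs G} \<rparr>"

text \<open>Disjointness of the two vertex sets is enforced by tagging them in a sum type.\<close>

definition graph_union ::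
    "'a pair_pre_digraph \<Rightarrow> 'b pair_pre_digraph \<Rightarrow> ('a + 'b) pair_pre_digraph" where
  "graph_union G H = \<lparr> pverts = pverts G <+> pverts H,
     parcs = {(Inl u, Inl v) | u v. (u, v) \<in> parcs G} \<union> {(Inr u, Inr v) | u v. (u, v) \<in> parcs H} \<rparr>"

definition graph_join ::
    "'a pair_pre_digraph \<Rightarrow> 'b pair_pre_digraph \<Rightarrow> ('a + 'b) pair_pre_digraph" where
  "graph_join G H = \<lparr> pverts = pverts (graph_union G H),
     parcs = parcs (graph_union G H)
       \<union> {(Inl u, Inr v) | u v. u \<in> pverts G \<and> v \<in> pverts H}
       \<union> {(Inr v, Inl u) | u v. u \<in> pverts G \<and> v \<in> pverts H} \<rparr>"

definition complete_graph :: "nat \<Rightarrow> nat pair_pre_digraph" where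
  "complete_graph n = \<lparr> pverts = {..<n}, parcs = {(i, j). i < n \<and> j < n \<and> i \<noteq> j} \<rparr>"

definition path_graph :: "nat \<Rightarrow> nat pair_pre_digraph" where
  "path_graph n = \<lparr> pverts = {..<n},
     parcs = {(i, j). i < n \<and> j < n \<and> (j = Suc i \<or> i = Suc j)} \<rparr>"

definition adj_dist :: "'a pair_pre_digraph \<Rightarrow> 'a \<Rightarrow> 'a \<Rightarrow> nat" where
  "adj_dist G x y = (if x = y then 0 else if (x, y) \<in> parcs G then 1 else 2)"

text \<open>
  The vector of values at the elements of W, with W itself as index set. Outside W the function is
  undefined, so two representations are equal iff they agree at every element of W.
\<close>

definition adj_rep :: "'a pair_pre_digraph \<Rightarrow> 'a set \<Rightarrow> 'a \<Rightarrow> 'a \<Rightarrow> nat" where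
  "adj_rep G W v = restrict (adj_dist G v) W"

definition adj_resolving :: "'a pair_pre_digraph \<Rightarrow> 'a set \<Rightarrow> bool" where
  "adj_resolving G W \<longleftrightarrow> W \<subseteq> pverts G \<and> inj_on (adj_rep G W) (pverts G)"

definition adj_dim :: "'a pair_pre_digraph \<Rightarrow> nat" where
  "adj_dim G = (LEAST k. \<exists>W. adj_resolving G W \<and> card W = k)"

text \<open>
  The minimum exists, because the set of all vertices is resolving.
\<close>

lemma adj_rep_eq_iff:
  "adj_rep G W u = adj_rep G W v \<longleftrightarrow> (\<forall>w\<in>W. adj_dist G u w = adj_dist G v w)"
  by (auto simp: adj_rep_def restrict_def fun_eq_iff)

lemma adj_resolving_pverts: "adj_resolving G (pverts G)"
  unfolding adj_resolving_def
proof (intro conjI subset_refl inj_onI)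
  fix u v assume u: "u \<in> pverts G" and "adj_rep G (pverts G) u = adj_rep G (pverts G) v"
  then have "adj_dist G v u = adj_dist G u u" by (simp add: adj_rep_eq_iff)
  then show "u = v" by (simp add: adj_dist_def split: if_splits)
qed

lemma adj_dim_attained: "\<exists>W. adj_resolving G W \<and> card W = adj_dim G"
  unfolding adj_dim_def by (rule LeastI_ex) (use adj_resolving_pverts in blast)

lemma adj_dim_le: "adj_resolving G W \<Longrightarrow> adj_dim G \<le> card W"
  unfolding adj_dim_def by (rule Least_le) blast

text \<open>
  The constructions stay within finite simple graphs, and isomorphism of digraphs is here the
  usual isomorphism of graphs.
\<close>

lemma pair_graphI:
  assumes "finite (pverts G)" "parcs G \<subseteq> pverts G \<times> pverts G" "sym (parcs G)" "irrefl (parcs G)"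
  shows "pair_graph G"
proof -
  have "finite (parcs G)" using assms(1,2) by (meson finite_SigmaI finite_subset)
  moreover have "fst e \<in> pverts G" "snd e \<in> pverts G" "fst e \<noteq> snd e" if "e \<in> parcs G" for e
    using that assms(2,4) by (cases e; force simp: irrefl_def)+
  ultimately show ?thesis
    using assms(1,3) by unfold_locales (simp_all add: symmetric_def)
qed

lemma pair_graphD:
  assumes "pair_graph G"
  shows "finite (pverts G)" "parcs G \<subseteq> pverts G \<times> pverts G" "sym (parcs G)" "irrefl (parcs G)"
proof -
  interpret pair_graph G by fact
  show "finite (pverts G)" by (rule pair_finite_verts)
  show "parcs G \<subseteq> pverts G \<times> pverts G" by (auto dest: in_arcsD1 in_arcsD2)
  show "sym (parcs G)" using pair_sym_arcs by (simp add: symmetric_def)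
  show "irrefl (parcs G)" using pair_no_loops by (force simp: irrefl_def)
qed

lemma pair_graph_complement:
  assumes "pair_graph G"
  shows "pair_graph (graph_complement G)"
proof -
  note G = pair_graphD[OF assms]
  show ?thesis
    by (rule pair_graphI)
      (use G(1) in \<open>auto simp: graph_complement_def irrefl_def intro!: symI dest: symD[OF G(3)]\<close>)
qed

lemma pair_graph_union:
  assumes "pair_graph G" "pair_graph H"
  shows "pair_graph (graph_union G H)"
proof -
  note G = pair_graphD[OF assms(1)] and H = pair_graphD[OF assms(2)]
  show ?thesis
  proof (rule pair_graphI)
    show "parcs (graph_union G H) \<subseteq> pverts (graph_union G H) \<times> pverts (graph_union G H)"
      using G(2) H(2) by (auto simp: graph_union_def)
    show "sym (parcs (graph_union G H))"
      by (rule symI) (auto simp: graph_union_def dest: symD[OF G(3)] symD[OF H(3)])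
  qed (use G(1,4) H(1,4) in \<open>auto simp: graph_union_def irrefl_def\<close>)
qed

lemma pair_graph_join:
  assumes "pair_graph G" "pair_graph H"
  shows "pair_graph (graph_join G H)"
proof -
  note U = pair_graphD[OF pair_graph_union[OF assms]]
  show ?thesis
  proof (rule pair_graphI)
    show "parcs (graph_join G H) \<subseteq> pverts (graph_join G H) \<times> pverts (graph_join G H)"
      using U(2) by (auto simp: graph_join_def graph_union_def)
    show "sym (parcs (graph_join G H))"
      by (rule symI) (auto simp: graph_join_def dest: symD[OF U(3)])
  qed (use U(1,4) in \<open>auto simp: graph_join_def irrefl_def\<close>)
qed

lemma complete_digraph_complete_graph: "K\<^bsub>n\<^esub> (with_proj (complete_graph n))"
  by (auto simp: complete_digraph_pair_def complete_graph_def)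

lemma pair_graph_path_graph: "pair_graph (path_graph n)"
  by (rule pair_graphI) (auto simp: path_graph_def irrefl_def sym_def)

lemma digraph_iso_pair_graph_iff:
  assumes "pair_graph G" "pair_graph H"
  shows "digraph_iso (with_proj G) (with_proj H) \<longleftrightarrow>
    (\<exists>f. bij_betw f (pverts G) (pverts H) \<and>
      (\<forall>u\<in>pverts G. \<forall>v\<in>pverts G. (u, v) \<in> parcs G \<longleftrightarrow> (f u, f v) \<in> parcs H))"
    (is "?L \<longleftrightarrow> ?R")
proof
  interpret G: pair_graph G by fact
  assume ?L
  then obtain f where f: "pre_digraph.digraph_isomorphism (with_proj G) f"
    and H: "with_proj H = app_iso f (with_proj G)"
    unfolding digraph_iso_def by blast
  let ?g = "iso_verts f"
  have inj: "inj_on ?g (pverts G)"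
    using f by (simp add: pre_digraph.digraph_isomorphism_def)
  have verts: "pverts H = ?g ` pverts G" and arcs: "parcs H = iso_arcs f ` parcs G"
    and tail: "iso_tail f = fst" and head: "iso_head f = snd"
    using arg_cong[OF H, of verts] arg_cong[OF H, of arcs]
      arg_cong[OF H, of tail] arg_cong[OF H, of head] by simp_all
  have arc: "iso_arcs f a = (?g (fst a), ?g (snd a))" if "a \<in> parcs G" for a
    using f that tail head by (simp add: pre_digraph.digraph_isomorphism_def)
  have arcs': "parcs H = (\<lambda>a. (?g (fst a), ?g (snd a))) ` parcs G"
    unfolding arcs by (rule image_cong[OF refl arc])
  have "(u, v) \<in> parcs G \<longleftrightarrow> (?g u, ?g v) \<in> parcs H"
    if uv: "u \<in> pverts G" "v \<in> pverts G" for u v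
  proof
    assume "(u, v) \<in> parcs G"
    then show "(?g u, ?g v) \<in> parcs H" unfolding arcs' by (rule rev_image_eqI) simp
  next
    assume "(?g u, ?g v) \<in> parcs H"
    then obtain x y where xy: "(x, y) \<in> parcs G" "?g u = ?g x" "?g v = ?g y"
      unfolding arcs' by auto
    then have "x = u" "y = v"
      using inj uv G.in_arcsD1[OF xy(1)] G.in_arcsD2[OF xy(1)] by (auto dest: inj_onD)
    then show "(u, v) \<in> parcs G" using xy(1) by simp
  qed
  then show ?R using inj verts unfolding bij_betw_def by blast
next
  interpret G: pair_graph G by fact
  interpret H: pair_graph H by fact
  assume ?R
  then obtain f where f: "inj_on f (pverts G)" "f ` pverts G = pverts H"
    and adj: "\<And>u v. u \<in> pverts G \<Longrightarrow> v \<in> pverts G \<Longrightarrow> (u, v) \<in> parcs G \<longleftrightarrow> (f u, f v) \<in> parcs H"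
    unfolding bij_betw_def by blast
  let ?h = "\<lparr> iso_verts = f, iso_arcs = map_prod f f, iso_head = snd, iso_tail = fst \<rparr>"
  have "inj_on (map_prod f f) (parcs G)"
    using map_prod_inj_on[OF f(1) f(1)] pair_graphD(2)[OF assms(1)] by (rule inj_on_subset)
  then have "pre_digraph.digraph_isomorphism (with_proj G) ?h"
    using f(1) G.wf_digraph_axioms by (simp add: pre_digraph.digraph_isomorphism_def)
  moreover have "parcs H = map_prod f f ` parcs G"
  proof
    show "parcs H \<subseteq> map_prod f f ` parcs G"
    proof (rule subrelI)
      fix x y assume xy: "(x, y) \<in> parcs H"
      then have "x \<in> f ` pverts G" "y \<in> f ` pverts G"
        using H.in_arcsD1[OF xy] H.in_arcsD2[OF xy] f(2) by simp_all
      then obtain u v where uv: "u \<in> pverts G" "v \<in> pverts G" "x = f u" "y = f v" by blast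
      then have "(u, v) \<in> parcs G" using xy adj by simp
      then show "(x, y) \<in> map_prod f f ` parcs G" using uv by (auto intro: rev_image_eqI)
    qed
    show "map_prod f f ` parcs G \<subseteq> parcs H"
    proof (rule image_subsetI)
      fix e assume "e \<in> parcs G"
      then obtain u v where uv: "e = (u, v)" "(u, v) \<in> parcs G" by (cases e) blast
      then show "map_prod f f e \<in> parcs H"
        using adj[OF G.in_arcsD1[OF uv(2)] G.in_arcsD2[OF uv(2)]] by simp
    qed
  qed
  then have "with_proj H = app_iso ?h (with_proj G)"
    using f(2) by (simp add: app_iso_def with_proj_def)
  ultimately show ?L unfolding digraph_iso_def by blast
qed

text \<open>
  A graph of order 2 is the complete bipartite graph with two parts of size 1, or the complement of
  it, but its adjacency dimension is 1, not 0. So a characterisation of the graphs whose adjacency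
  dimension is the order minus 2 can only list this graph if order 2 is excluded.
\<close>

lemma order_two_exception:
  assumes "pair_graph G" "card (pverts G) = 2"
  shows "adj_dim G = 1"
    and "K\<^bsub>1,1\<^esub> (with_proj G) \<or> K\<^bsub>1,1\<^esub> (with_proj (graph_complement G))"
proof -
  obtain a b where V: "pverts G = {a, b}" and ab: "a \<noteq> b"
    using assms(2) by (auto simp: card_2_iff)
  note G = pair_graphD[OF assms(1)]
  have "adj_resolving G {a}"
    using V ab by (auto simp: adj_resolving_def inj_on_def adj_rep_eq_iff adj_dist_def)
  then have "adj_dim G \<le> 1" by (drule_tac adj_dim_le) simp
  moreover have "adj_dim G \<noteq> 0"
  proof
    assume "adj_dim G = 0"
    then obtain W where W: "adj_resolving G W" "card W = 0" using adj_dim_attained by metis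
    then have "W = {}" using G(1) by (auto simp: adj_resolving_def dest: finite_subset)
    then show False using W(1) V ab by (auto simp: adj_resolving_def inj_on_def adj_rep_eq_iff)
  qed
  ultimately show "adj_dim G = 1" by simp
  have sub: "parcs G \<subseteq> {(a, b), (b, a)}"
    using G(2) V irreflD[OF G(4)] by auto
  show "K\<^bsub>1,1\<^esub> (with_proj G) \<or> K\<^bsub>1,1\<^esub> (with_proj (graph_complement G))"
  proof (cases "(a, b) \<in> parcs G")
    case True
    then have parcs: "parcs G = {a} \<times> {b} \<union> {b} \<times> {a}"
      using sub symD[OF G(3) True] by auto
    have "K\<^bsub>1,1\<^esub> (with_proj G)"
      unfolding complete_bipartite_digraph_pair_def
      by (intro conjI, simp add: V, rule exI[where x = "{a}"], rule exI[where x = "{b}"])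
        (use parcs V ab in auto)
    then show ?thesis ..
  next
    case False
    then have "(b, a) \<notin> parcs G" using symD[OF G(3)] by blast
    then have parcs: "parcs (graph_complement G) = {a} \<times> {b} \<union> {b} \<times> {a}"
      using False V ab by (auto simp: graph_complement_def)
    have pverts: "pverts (graph_complement G) = {a, b}"
      using V by (simp add: graph_complement_def)
    have "K\<^bsub>1,1\<^esub> (with_proj (graph_complement G))"
      unfolding complete_bipartite_digraph_pair_def
      by (intro conjI, simp add: pverts, rule exI[where x = "{a}"], rule exI[where x = "{b}"])
        (use parcs pverts ab in auto)
    then show ?thesis ..
  qed
qed

end

theory Submission
  imports Defs
begin

text \<open>
  A set is resolving iff any two vertices outside it are separated by a vertex of it, that is, by a
  vertex adjacent to exactly one of them. Hence the dimension is the order minus 2 iff some two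
  vertices are separated by a third, while every triple contains a pair which at most the remaining
  vertex of the triple separates. Both conditions are invariant under complementation. Being
  separated by no vertex is an equivalence relation whose classes are cliques or independent sets,
  and vertices of different classes are joined or not according to the classes alone.
  Two classes give a complete bipartite graph or a complete split graph, up to complement. With
  exactly three classes, the triple condition makes one class a singleton that alone separates the
  other two, which gives the graphs \<open>K\<^sub>s \<or> (K\<^sub>t \<union> K\<^sub>1)\<close> up to complement. Four vertices from different
  classes must induce a path, and any further vertex would violate the triple condition.
\<close>

section \<open>Separation of vertices\<close>

text \<open>Leaving out \<open>u\<close> and \<open>v\<close> as separators restricts the comparison
  to the values 1 and 2 of \<open>adj_dist\<close> and makes the relation insensitive to
  complementation.\<close>

definition separates :: "'a pair_pre_digraph \<Rightarrow> 'a \<Rightarrow> 'a \<Rightarrow> 'a \<Rightarrow> bool" where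
  "separates G w u v \<longleftrightarrow> w \<noteq> u \<and> w \<noteq> v \<and> ((u, w) \<in> parcs G) \<noteq> ((v, w) \<in> parcs G)"

text \<open>Adjacent and non-adjacent twins together: adjacency between \<open>u\<close> and
  \<open>v\<close> themselves is not tested.\<close>

definition twins :: "'a pair_pre_digraph \<Rightarrow> 'a \<Rightarrow> 'a \<Rightarrow> bool" where
  "twins G u v \<longleftrightarrow> (\<forall>w\<in>pverts G. \<not> separates G w u v)"

text \<open>\<open>z\<close> is the only separator that is tolerated, not one that must occur, so
  twins satisfy this for every \<open>z\<close>.\<close>

definition twins_but :: "'a pair_pre_digraph \<Rightarrow> 'a \<Rightarrow> 'a \<Rightarrow> 'a \<Rightarrow> bool" where
  "twins_but G z u v \<longleftrightarrow> (\<forall>w\<in>pverts G. separates G w u v \<longrightarrow> w = z)"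

text \<open>Negated, this says that some three vertices can be left out of a resolving set together:
  each two of them then have a separator outside the triple.\<close>

definition degenerate_triples :: "'a pair_pre_digraph \<Rightarrow> bool" where
  "degenerate_triples G \<longleftrightarrow> (\<forall>x\<in>pverts G. \<forall>y\<in>pverts G. \<forall>z\<in>pverts G.
     x \<noteq> y \<longrightarrow> x \<noteq> z \<longrightarrow> y \<noteq> z \<longrightarrow> twins_but G z x y \<or> twins_but G y x z \<or> twins_but G x y z)"

section \<open>Resolving sets and the adjacency dimension\<close>

lemma separates_commute: "separates G w u v \<longleftrightarrow> separates G w v u"
  unfolding separates_def by blast

text \<open>A member of \<open>W\<close> is the only vertex with value 0 at itself. Two vertices
  outside \<open>W\<close> take only the values 1 and 2 on \<open>W\<close>, so exactly the
  separators in \<open>W\<close> tell them apart.\<close>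

lemma adj_resolving_iff:
  assumes "W \<subseteq> pverts G"
  shows "adj_resolving G W \<longleftrightarrow>
    (\<forall>u\<in>pverts G - W. \<forall>v\<in>pverts G - W. u \<noteq> v \<longrightarrow> (\<exists>w\<in>W. separates G w u v))"
proof -
  have *: "(\<exists>w\<in>W. adj_dist G u w \<noteq> adj_dist G v w) \<longleftrightarrow>
      u \<in> W \<or> v \<in> W \<or> (\<exists>w\<in>W. separates G w u v)" if "u \<noteq> v" for u v
    using that by (auto simp: adj_dist_def separates_def split: if_splits)
  have "adj_resolving G W \<longleftrightarrow> (\<forall>u\<in>pverts G. \<forall>v\<in>pverts G. u \<noteq> v \<longrightarrow>
      (\<exists>w\<in>W. adj_dist G u w \<noteq> adj_dist G v w))"
    using assms unfolding adj_resolving_def inj_on_def adj_rep_eq_iff by blast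
  also have "\<dots> \<longleftrightarrow> (\<forall>u\<in>pverts G. \<forall>v\<in>pverts G. u \<noteq> v \<longrightarrow>
      u \<in> W \<or> v \<in> W \<or> (\<exists>w\<in>W. separates G w u v))"
    using * by blast
  finally show ?thesis by blast
qed

lemma adj_resolving_Diff_iff:
  assumes "T \<subseteq> pverts G"
  shows "adj_resolving G (pverts G - T) \<longleftrightarrow>
    (\<forall>u\<in>T. \<forall>v\<in>T. u \<noteq> v \<longrightarrow> (\<exists>w\<in>pverts G - T. separates G w u v))"
proof -
  have "pverts G - (pverts G - T) = T" using assms by blast
  then show ?thesis by (simp add: adj_resolving_iff)
qed

lemma adj_resolving_mono:
  assumes "adj_resolving G W" "W \<subseteq> W'" "W' \<subseteq> pverts G"
  shows "adj_resolving G W'"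
proof -
  have "u = v" if "u \<in> pverts G" "v \<in> pverts G" "adj_rep G W' u = adj_rep G W' v" for u v
  proof -
    have "adj_rep G W u = adj_rep G W v" using that(3) assms(2) by (auto simp: adj_rep_eq_iff)
    then show ?thesis using assms(1) that(1,2) by (simp add: adj_resolving_def inj_on_def)
  qed
  then show ?thesis using assms(3) by (simp add: adj_resolving_def inj_on_def)
qed

text \<open>Resolving sets are described by the vertices they omit. Since supersets of resolving
  sets resolve, a minimum one that omits at least \<open>k\<close> vertices can be enlarged until it
  omits exactly \<open>k\<close>. The bound on \<open>k\<close> keeps the natural subtraction from
  truncating.\<close>

lemma adj_dim_le_iff:
  assumes "finite (pverts G)" "k \<le> card (pverts G)"
  shows "adj_dim G \<le> card (pverts G) - k \<longleftrightarrow>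
    (\<exists>T. T \<subseteq> pverts G \<and> card T = k \<and> adj_resolving G (pverts G - T))"
proof
  assume le: "adj_dim G \<le> card (pverts G) - k"
  obtain W where W: "adj_resolving G W" "card W = adj_dim G"
    using adj_dim_attained by blast
  then have sub: "W \<subseteq> pverts G" by (simp add: adj_resolving_def)
  then have "card (pverts G - W) = card (pverts G) - adj_dim G"
    using assms(1) W(2) by (simp add: card_Diff_subset finite_subset)
  then have "k \<le> card (pverts G - W)" using le assms(2) by linarith
  then obtain T where T: "T \<subseteq> pverts G - W" "card T = k"
    by (rule obtain_subset_with_card_n)
  then have "adj_resolving G (pverts G - T)"
    using sub by (intro adj_resolving_mono[OF W(1)]) auto
  then show "\<exists>T. T \<subseteq> pverts G \<and> card T = k \<and> adj_resolving G (pverts G - T)"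
    using T by blast
next
  assume "\<exists>T. T \<subseteq> pverts G \<and> card T = k \<and> adj_resolving G (pverts G - T)"
  then obtain T where T: "T \<subseteq> pverts G" "card T = k" "adj_resolving G (pverts G - T)" by blast
  then have "card (pverts G - T) = card (pverts G) - k"
    using assms(1) by (simp add: card_Diff_subset finite_subset)
  then show "adj_dim G \<le> card (pverts G) - k"
    using adj_dim_le[OF T(3)] by simp
qed

text \<open>Dimension order minus 2 means that two vertices can be omitted but not three. For a
  pair, any separator already lies outside it; for a triple, the separator of two members must also
  differ from the third, which is what the negation of \<open>twins_but\<close> gives. From order 3
  on, both natural subtractions are exact.\<close>

lemma adj_dim_eq_order_minus_two_iff:
  assumes "finite (pverts G)" "3 \<le> card (pverts G)"
  shows "int (adj_dim G) = int (card (pverts G)) - 2 \<longleftrightarrow>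
    (\<exists>u\<in>pverts G. \<exists>v\<in>pverts G. \<not> twins G u v) \<and> degenerate_triples G"
proof -
  let ?V = "pverts G"
  have "adj_dim G \<le> card ?V - 2 \<longleftrightarrow> (\<exists>u\<in>?V. \<exists>v\<in>?V. \<not> twins G u v)"
  proof -
    have "(\<exists>T. T \<subseteq> ?V \<and> card T = 2 \<and> adj_resolving G (?V - T)) \<longleftrightarrow>
        (\<exists>u\<in>?V. \<exists>v\<in>?V. \<not> twins G u v)" (is "?L \<longleftrightarrow> ?R")
    proof
      assume ?L
      then obtain T where T: "T \<subseteq> ?V" "card T = 2" "adj_resolving G (?V - T)" by blast
      then obtain u v where uv: "T = {u, v}" "u \<noteq> v" by (auto simp: card_2_iff)
      then have "\<exists>w\<in>?V - T. separates G w u v" using T by (simp add: adj_resolving_Diff_iff)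
      then show ?R using T uv unfolding twins_def by blast
    next
      assume ?R
      then obtain u v w where uvw: "u \<in> ?V" "v \<in> ?V" "w \<in> ?V" and sep: "separates G w u v"
        unfolding twins_def by blast
      have "u \<noteq> v" and w: "w \<in> ?V - {u, v}"
        using sep uvw(3) by (auto simp: separates_def)
      have "separates G w v u" using sep by (simp add: separates_commute)
      then have "adj_resolving G (?V - {u, v})"
        using uvw(1,2) sep w by (subst adj_resolving_Diff_iff) blast+
      then show ?L using uvw \<open>u \<noteq> v\<close> by (intro exI[of _ "{u, v}"]) auto
    qed
    then show ?thesis using adj_dim_le_iff[of G 2] assms by simp
  qed
  moreover have "adj_dim G \<le> card ?V - 3 \<longleftrightarrow> \<not> degenerate_triples G"
  proof -
    have "(\<exists>T. T \<subseteq> ?V \<and> card T = 3 \<and> adj_resolving G (?V - T)) \<longleftrightarrow> \<not> degenerate_triples G"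
      (is "?L \<longleftrightarrow> ?R")
    proof
      assume ?L
      then obtain T where T: "T \<subseteq> ?V" "card T = 3" "adj_resolving G (?V - T)" by blast
      then obtain x y z where xyz: "T = {x, y, z}" "x \<noteq> y" "x \<noteq> z" "y \<noteq> z"
        by (auto simp: card_3_iff)
      then have V: "x \<in> ?V" "y \<in> ?V" "z \<in> ?V" using T by auto
      have sep: "\<exists>w\<in>?V - T. separates G w u v" if "u \<in> T" "v \<in> T" "u \<noteq> v" for u v
        using T that by (simp add: adj_resolving_Diff_iff)
      have "\<not> twins_but G z x y" "\<not> twins_but G y x z" "\<not> twins_but G x y z"
        using sep[of x y] sep[of x z] sep[of y z] xyz unfolding twins_but_def by auto
      then show ?R using V xyz unfolding degenerate_triples_def by blast
    next
      assume ?R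
      then obtain x y z where V: "x \<in> ?V" "y \<in> ?V" "z \<in> ?V" and ne: "x \<noteq> y" "x \<noteq> z" "y \<noteq> z"
        and nt: "\<not> twins_but G z x y" "\<not> twins_but G y x z" "\<not> twins_but G x y z"
        unfolding degenerate_triples_def by blast
      let ?T = "{x, y, z}"
      have "\<exists>w\<in>?V - ?T. separates G w x y" "\<exists>w\<in>?V - ?T. separates G w x z"
          "\<exists>w\<in>?V - ?T. separates G w y z"
        using nt unfolding twins_but_def separates_def by blast+
      then have "\<exists>w\<in>?V - ?T. separates G w u v" if "u \<in> ?T" "v \<in> ?T" "u \<noteq> v" for u v
        using that separates_commute[of G] by auto
      then have "adj_resolving G (?V - ?T)"
        using V by (subst adj_resolving_Diff_iff) auto
      then show ?L using V ne by (intro exI[of _ ?T]) auto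
    qed
    then show ?thesis using adj_dim_le_iff[of G 3] assms by simp
  qed
  ultimately show ?thesis using assms(2) by linarith
qed

section \<open>Invariance under complementation\<close>

lemma separates_complement:
  assumes "u \<in> pverts G" "v \<in> pverts G" "w \<in> pverts G"
  shows "separates (graph_complement G) w u v \<longleftrightarrow> separates G w u v"
  using assms by (auto simp: separates_def graph_complement_def)

lemma pverts_complement [simp]: "pverts (graph_complement G) = pverts G"
  by (simp add: graph_complement_def)

lemma twins_complement:
  assumes "u \<in> pverts G" "v \<in> pverts G"
  shows "twins (graph_complement G) u v \<longleftrightarrow> twins G u v"
  using assms by (simp add: twins_def separates_complement)

lemma degenerate_triples_complement:
  "degenerate_triples (graph_complement G) \<longleftrightarrow> degenerate_triples G"
  by (simp add: degenerate_triples_def twins_but_def separates_complement)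

section \<open>Being twins as an equivalence relation\<close>

lemma twins_refl: "twins G u u"
  by (simp add: twins_def separates_def)

lemma twins_sym: "twins G u v \<Longrightarrow> twins G v u"
  by (simp add: twins_def separates_commute)

lemma twins_trans:
  assumes G: "pair_graph G" and V: "u \<in> pverts G" "v \<in> pverts G" "w \<in> pverts G"
    and "twins G u v" "twins G v w"
  shows "twins G u w"
proof -
  have s: "(x, y) \<in> parcs G \<longleftrightarrow> (y, x) \<in> parcs G" for x y
    using symD[OF pair_graphD(3)[OF G]] by blast
  have "\<not> separates G x u w" if x: "x \<in> pverts G" for x
  proof (cases "x = v")
    case True
    \<comment> \<open>For distinct vertices, the first fact makes \<open>v\<close> and
      \<open>u\<close> agree at \<open>w\<close>, the second makes \<open>v\<close> and
      \<open>w\<close> agree at \<open>u\<close>. By symmetry both \<open>vw\<close> and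
      \<open>vu\<close> have the status of \<open>uw\<close>, so the middle vertex \<open>v\<close>
      does not separate \<open>u\<close> from \<open>w\<close>.\<close>
    have "\<not> separates G w u v" "\<not> separates G u v w"
      using assms by (auto simp: twins_def)
    then show ?thesis
      using True s by (auto simp: separates_def)
  next
    case False
    have "\<not> separates G x u v" "\<not> separates G x v w"
      using assms x by (auto simp: twins_def)
    then show ?thesis using False by (auto simp: separates_def)
  qed
  then show ?thesis by (simp add: twins_def)
qed

text \<open>The bijection runs from the model \<open>H\<close> to \<open>G\<close>, so that the
  parts of \<open>G\<close> arise as images of the parts of \<open>H\<close>, and witnesses are maps
  on the explicit vertex set of the model.\<close>

lemma digraph_iso_inverse_iff:
  assumes G: "pair_graph G" and H: "pair_graph H"
  shows "digraph_iso (with_proj G) (with_proj H) \<longleftrightarrow>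
    (\<exists>g. bij_betw g (pverts H) (pverts G) \<and>
      (\<forall>x\<in>pverts H. \<forall>y\<in>pverts H. (x, y) \<in> parcs H \<longleftrightarrow> (g x, g y) \<in> parcs G))"
proof -
  interpret G: pair_graph G by fact
  interpret H: pair_graph H by fact
  have "digraph_iso (with_proj G) (with_proj H) \<longleftrightarrow> digraph_iso (with_proj H) (with_proj G)"
    using digraph_iso_swap[OF G.wf_digraph_axioms] digraph_iso_swap[OF H.wf_digraph_axioms] by blast
  then show ?thesis by (simp add: digraph_iso_pair_graph_iff[OF H G])
qed

section \<open>The exceptional graphs\<close>

text \<open>Only one order of each pair is recorded; symmetry and the absence of loops in a
  \<open>pair_graph\<close> supply the rest.\<close>

definition is_path4 :: "'a pair_pre_digraph \<Rightarrow> 'a \<Rightarrow> 'a \<Rightarrow> 'a \<Rightarrow> 'a \<Rightarrow> bool" where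
  "is_path4 G a b c d \<longleftrightarrow> distinct [a, b, c, d] \<and> pverts G = {a, b, c, d} \<and>
     (a, b) \<in> parcs G \<and> (b, c) \<in> parcs G \<and> (c, d) \<in> parcs G \<and>
     (a, c) \<notin> parcs G \<and> (a, d) \<notin> parcs G \<and> (b, d) \<notin> parcs G"

definition is_biclique :: "'a pair_pre_digraph \<Rightarrow> 'a set \<Rightarrow> 'a set \<Rightarrow> bool" where
  "is_biclique G A B \<longleftrightarrow> A \<noteq> {} \<and> B \<noteq> {} \<and> A \<inter> B = {} \<and> pverts G = A \<union> B \<and>
     (\<forall>u\<in>pverts G. \<forall>v\<in>pverts G. (u, v) \<in> parcs G \<longleftrightarrow> (u \<in> A) \<noteq> (v \<in> A))"

text \<open>The join of a clique \<open>A\<close> with an independent set \<open>B\<close>.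
  Adjacency is expressed by equality and membership in \<open>A\<close> alone, which transfer along
  injections.\<close>

definition is_complete_split :: "'a pair_pre_digraph \<Rightarrow> 'a set \<Rightarrow> 'a set \<Rightarrow> bool" where
  "is_complete_split G A B \<longleftrightarrow> A \<noteq> {} \<and> 2 \<le> card B \<and> A \<inter> B = {} \<and> pverts G = A \<union> B \<and>
     (\<forall>u\<in>pverts G. \<forall>v\<in>pverts G. (u, v) \<in> parcs G \<longleftrightarrow> u \<noteq> v \<and> (u \<in> A \<or> v \<in> A))"

text \<open>\<open>A\<close>, \<open>B\<close> and \<open>c\<close> play the parts of
  \<open>K_s\<close>, \<open>K_t\<close> and \<open>K_1\<close>: a complete graph from which the
  edges between \<open>c\<close> and \<open>B\<close> are removed.\<close>

definition is_clique_with_satellite ::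
    "'a pair_pre_digraph \<Rightarrow> 'a set \<Rightarrow> 'a set \<Rightarrow> 'a \<Rightarrow> bool" where
  "is_clique_with_satellite G A B c \<longleftrightarrow> A \<noteq> {} \<and> B \<noteq> {} \<and> A \<inter> B = {} \<and> c \<notin> A \<union> B \<and>
     pverts G = insert c (A \<union> B) \<and>
     (\<forall>u\<in>pverts G. \<forall>v\<in>pverts G. (u, v) \<in> parcs G \<longleftrightarrow>
        u \<noteq> v \<and> (u \<in> A \<or> v \<in> A \<or> u \<noteq> c \<and> v \<noteq> c))"

section \<open>Isomorphism with the listed graphs\<close>

lemma ex_inj_on_lessThan:
  assumes "finite A"
  obtains g where "inj_on g {..<card A}" "g ` {..<card A} = A"
proof -
  obtain h where "bij_betw h {0..<card A} A"
    using ex_bij_betw_nat_finite[OF assms] ..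
  then show ?thesis by (intro that[of h]) (simp_all add: bij_betw_def lessThan_atLeast0)
qed

lemma pair_graph_arc_commute:
  "pair_graph G \<Longrightarrow> (u, v) \<in> parcs G \<longleftrightarrow> (v, u) \<in> parcs G"
  using pair_graphD(3) by (blast dest: symD)

lemma pair_graph_no_loop: "pair_graph G \<Longrightarrow> (u, u) \<notin> parcs G"
  using pair_graphD(4) by (blast dest: irreflD)

lemma iso_path4_iff:
  assumes G: "pair_graph G"
  shows "digraph_iso (with_proj G) (with_proj (path_graph 4)) \<longleftrightarrow> (\<exists>a b c d. is_path4 G a b c d)"
proof -
  have V: "pverts (path_graph 4) = {0, 1, 2, 3}"
    by (auto simp: path_graph_def)
  have E: "(i, j) \<in> parcs (path_graph 4) \<longleftrightarrow> i < 4 \<and> j < 4 \<and> (j = Suc i \<or> i = Suc j)" for i j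
    by (simp add: path_graph_def)
  note loop = pair_graph_no_loop[OF G]
  show ?thesis
    unfolding digraph_iso_inverse_iff[OF G pair_graph_path_graph] V
  proof (rule iffI; elim exE conjE)
    fix g assume g: "bij_betw g {0, 1, 2, 3} (pverts G)" and
      "\<forall>x\<in>{0, 1, 2, 3}. \<forall>y\<in>{0, 1, 2, 3}. (x, y) \<in> parcs (path_graph 4) \<longleftrightarrow> (g x, g y) \<in> parcs G"
    then have "is_path4 G (g 0) (g 1) (g 2) (g 3)"
      by (auto simp: is_path4_def E bij_betw_def)
    then show "\<exists>a b c d. is_path4 G a b c d" by blast
  next
    fix a b c d assume P: "is_path4 G a b c d"
    define g :: "nat \<Rightarrow> 'a" where "g i = [a, b, c, d] ! i" for i
    have "g 0 = a" "g 1 = b" "g 2 = c" "g 3 = d" by (simp_all add: g_def)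
    moreover have "(b, a) \<in> parcs G" "(c, b) \<in> parcs G" "(d, c) \<in> parcs G"
      "(c, a) \<notin> parcs G" "(d, a) \<notin> parcs G" "(d, b) \<notin> parcs G"
      using P pair_graph_arc_commute[OF G] unfolding is_path4_def by blast+
    ultimately show "\<exists>g. bij_betw g {0, 1, 2, 3} (pverts G) \<and>
      (\<forall>x\<in>{0, 1, 2, 3}. \<forall>y\<in>{0, 1, 2, 3}. (x, y) \<in> parcs (path_graph 4) \<longleftrightarrow> (g x, g y) \<in> parcs G)"
      using P loop by (intro exI[of _ g]) (simp add: is_path4_def E bij_betw_def)
  qed
qed

text \<open>\<open>complete_bipartite_digraph\<close> already names two parts inside the vertex set,
  so no isomorphism has to be built; by finiteness, parts of size at least 1 are the nonempty
  ones.\<close>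

lemma biclique_iff:
  assumes G: "pair_graph G"
  shows "(\<exists>s t. s \<ge> 1 \<and> t \<ge> 1 \<and> complete_bipartite_digraph s t (with_proj G)) \<longleftrightarrow>
    (\<exists>A B. is_biclique G A B)" (is "?L \<longleftrightarrow> ?R")
proof
  assume ?L
  then obtain A B where AB: "card A \<ge> 1" "card B \<ge> 1" "A \<inter> B = {}" "pverts G = A \<union> B"
    "parcs G = A \<times> B \<union> B \<times> A"
    unfolding complete_bipartite_digraph_pair_def by blast
  then have "A \<noteq> {}" "B \<noteq> {}" by auto
  then have "is_biclique G A B"
    using AB unfolding is_biclique_def by auto
  then show ?R by blast
next
  assume ?R
  then obtain A B where AB: "is_biclique G A B" by blast
  have fin: "finite (pverts G)" and sub: "parcs G \<subseteq> pverts G \<times> pverts G"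
    using pair_graphD[OF assms] by simp_all
  then have "card A \<ge> 1" "card B \<ge> 1"
    using AB by (auto simp: is_biclique_def Suc_le_eq card_gt_0_iff)
  moreover have "parcs G = A \<times> B \<union> B \<times> A"
    using AB sub unfolding is_biclique_def by auto
  then have "complete_bipartite_digraph (card A) (card B) (with_proj G)"
    using AB fin unfolding complete_bipartite_digraph_pair_def is_biclique_def by blast
  ultimately show ?L by blast
qed

lemma pair_graph_complete_graph: "pair_graph (complete_graph n)"
  by (rule pair_graphI) (auto simp: complete_graph_def irrefl_def sym_def)

lemma iso_complete_split_iff:
  assumes G: "pair_graph G"
  shows "(\<exists>s t. s \<ge> 1 \<and> t \<ge> 2 \<and> digraph_iso (with_proj G)
      (with_proj (graph_join (complete_graph s) (graph_complement (complete_graph t))))) \<longleftrightarrow>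
    (\<exists>A B. is_complete_split G A B)"
proof -
  let ?H = "\<lambda>s t. graph_join (complete_graph s) (graph_complement (complete_graph t))"
  have H: "pair_graph (?H s t)" for s t
    by (intro pair_graph_join pair_graph_complement pair_graph_complete_graph)
  have V: "pverts (?H s t) = Inl ` {..<s} \<union> Inr ` {..<t}" for s t
    by (auto simp: graph_join_def graph_union_def graph_complement_def complete_graph_def)
  \<comment> \<open>Only equality and membership in the left summand enter; an injective map
    preserves and reflects both.\<close>
  have E: "(x, y) \<in> parcs (?H s t) \<longleftrightarrow> x \<noteq> y \<and> (x \<in> Inl ` {..<s} \<or> y \<in> Inl ` {..<s})"
    if "x \<in> pverts (?H s t)" "y \<in> pverts (?H s t)" for s t x y
    using that unfolding V
    by (auto simp: graph_join_def graph_union_def graph_complement_def complete_graph_def)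
  show ?thesis
    unfolding digraph_iso_inverse_iff[OF G H]
  proof (intro iffI; elim exE conjE)
    fix s t :: nat and g :: "nat + nat \<Rightarrow> 'a"
    assume st: "1 \<le> s" "2 \<le> t" and bij: "bij_betw g (pverts (?H s t)) (pverts G)" and
      arc: "\<forall>x\<in>pverts (?H s t). \<forall>y\<in>pverts (?H s t).
        (x, y) \<in> parcs (?H s t) \<longleftrightarrow> (g x, g y) \<in> parcs G"
    have inj: "inj_on g (pverts (?H s t))" and img: "pverts G = g ` pverts (?H s t)"
      using bij by (simp_all add: bij_betw_def)
    let ?A = "g ` Inl ` {..<s}" and ?B = "g ` Inr ` {..<t}"
    have A: "g x \<in> ?A \<longleftrightarrow> x \<in> Inl ` {..<s}" if "x \<in> pverts (?H s t)" for x
      using inj that by (rule inj_on_image_mem_iff) (simp add: V)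
    have "is_complete_split G ?A ?B"
      unfolding is_complete_split_def
    proof (intro conjI)
      show "?A \<noteq> {}" using st by (auto simp: lessThan_empty_iff bot_nat_def)
      have "inj_on g (Inr ` {..<t})" using inj by (rule inj_on_subset) (simp add: V)
      then show "2 \<le> card ?B" using st by (simp add: card_image)
      have "g ` (Inl ` {..<s} \<inter> Inr ` {..<t}) = ?A \<inter> ?B"
        using inj by (rule inj_on_image_Int) (simp_all add: V)
      then show "?A \<inter> ?B = {}" by auto
      show "pverts G = ?A \<union> ?B" unfolding img V by (simp add: image_Un)
      show "\<forall>u\<in>pverts G. \<forall>v\<in>pverts G. (u, v) \<in> parcs G \<longleftrightarrow> u \<noteq> v \<and> (u \<in> ?A \<or> v \<in> ?A)"
        unfolding img ball_simps using arc inj_on_eq_iff[OF inj] A E by simp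
    qed
    then show "\<exists>A B. is_complete_split G A B" by blast
  next
    fix A B assume AB: "is_complete_split G A B"
    then have fin: "finite A" "finite B" and disj: "A \<inter> B = {}" and un: "pverts G = A \<union> B"
      using pair_graphD(1)[OF assms] by (auto simp: is_complete_split_def)
    obtain gA where gA: "inj_on gA {..<card A}" "gA ` {..<card A} = A"
      using fin(1) by (rule ex_inj_on_lessThan)
    obtain gB where gB: "inj_on gB {..<card B}" "gB ` {..<card B} = B"
      using fin(2) by (rule ex_inj_on_lessThan)
    let ?V = "pverts (?H (card A) (card B))"
    \<comment> \<open>Enumerations of \<open>A\<close> and \<open>B\<close> on the two summands;
      they are jointly injective because \<open>A\<close> and \<open>B\<close> are disjoint.\<close>
    let ?g = "case_sum gA gB"
    have img: "?g ` Inl ` {..<card A} = A" "?g ` Inr ` {..<card B} = B"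
      using gA(2) gB(2) by (simp_all add: image_image)
    have inj: "inj_on ?g ?V"
    proof -
      have "inj_on ?g (Inl ` {..<card A})" "inj_on ?g (Inr ` {..<card B})"
        using gA(1) gB(1) by (auto simp: inj_on_def)
      then show ?thesis
        unfolding V inj_on_Un using img disj by auto
    qed
    have A: "?g x \<in> A \<longleftrightarrow> x \<in> Inl ` {..<card A}" if "x \<in> ?V" for x
    proof -
      have "Inl ` {..<card A} \<subseteq> ?V" by (simp add: V)
      then show ?thesis using inj_on_image_mem_iff[OF inj that] img(1) by metis
    qed
    have bij: "bij_betw ?g ?V (pverts G)"
      using inj img un by (simp add: bij_betw_def V image_Un)
    have "\<forall>x\<in>?V. \<forall>y\<in>?V. (x, y) \<in> parcs (?H (card A) (card B)) \<longleftrightarrow>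
      (?g x, ?g y) \<in> parcs G"
    proof (intro ballI)
      fix x y assume x: "x \<in> ?V" and y: "y \<in> ?V"
      have "(?g x, ?g y) \<in> parcs G \<longleftrightarrow> ?g x \<noteq> ?g y \<and> (?g x \<in> A \<or> ?g y \<in> A)"
        using AB bij_betwE[OF bij] x y unfolding is_complete_split_def by blast
      then show "(x, y) \<in> parcs (?H (card A) (card B)) \<longleftrightarrow> (?g x, ?g y) \<in> parcs G"
        using E[OF x y] inj_on_eq_iff[OF inj x y] A[OF x] A[OF y] by simp
    qed
    moreover have "1 \<le> card A" "2 \<le> card B"
      using AB fin by (auto simp: is_complete_split_def Suc_le_eq card_gt_0_iff)
    ultimately show "\<exists>s t. 1 \<le> s \<and> 2 \<le> t \<and> (\<exists>g. bij_betw g (pverts (?H s t)) (pverts G) \<and>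
        (\<forall>x\<in>pverts (?H s t). \<forall>y\<in>pverts (?H s t).
          (x, y) \<in> parcs (?H s t) \<longleftrightarrow> (g x, g y) \<in> parcs G))"
      using bij by blast
  qed
qed

lemma iso_clique_with_satellite_iff:
  assumes G: "pair_graph G"
  shows "(\<exists>s t. s \<ge> 1 \<and> t \<ge> 1 \<and> digraph_iso (with_proj G) (with_proj
      (graph_join (complete_graph s) (graph_union (complete_graph t) (complete_graph 1))))) \<longleftrightarrow>
    (\<exists>A B c. is_clique_with_satellite G A B c)"
proof -
  note One_nat_def [simp del]
  let ?H = "\<lambda>s t. graph_join (complete_graph s) (graph_union (complete_graph t) (complete_graph 1))"
  \<comment> \<open>The vertex of \<open>complete_graph 1\<close>: on the right of the join and
    again on the right of the union.\<close>
  let ?C = "Inr (Inr 0) :: nat + nat + nat"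
  have H: "pair_graph (?H s t)" for s t
    by (intro pair_graph_join pair_graph_union pair_graph_complete_graph)
  have V: "pverts (?H s t) = insert ?C (Inl ` {..<s} \<union> Inr ` Inl ` {..<t})" for s t
    by (auto simp: graph_join_def graph_union_def complete_graph_def)
  have E: "(x, y) \<in> parcs (?H s t) \<longleftrightarrow>
      x \<noteq> y \<and> (x \<in> Inl ` {..<s} \<or> y \<in> Inl ` {..<s} \<or> x \<noteq> ?C \<and> y \<noteq> ?C)"
    if "x \<in> pverts (?H s t)" "y \<in> pverts (?H s t)" for s t x y
    using that unfolding V
    by (auto simp: graph_join_def graph_union_def complete_graph_def)
  show ?thesis
    unfolding digraph_iso_inverse_iff[OF G H]
  proof (intro iffI; elim exE conjE)
    fix s t :: nat and g :: "nat + nat + nat \<Rightarrow> 'a"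
    assume st: "1 \<le> s" "1 \<le> t" and bij: "bij_betw g (pverts (?H s t)) (pverts G)" and
      arc: "\<forall>x\<in>pverts (?H s t). \<forall>y\<in>pverts (?H s t).
        (x, y) \<in> parcs (?H s t) \<longleftrightarrow> (g x, g y) \<in> parcs G"
    have inj: "inj_on g (pverts (?H s t))" and img: "pverts G = g ` pverts (?H s t)"
      using bij by (simp_all add: bij_betw_def)
    let ?A = "g ` Inl ` {..<s}" and ?B = "g ` Inr ` Inl ` {..<t}"
    have A: "g x \<in> ?A \<longleftrightarrow> x \<in> Inl ` {..<s}" if "x \<in> pverts (?H s t)" for x
      using inj that by (rule inj_on_image_mem_iff) (auto simp: V)
    have B: "g x \<in> ?B \<longleftrightarrow> x \<in> Inr ` Inl ` {..<t}" if "x \<in> pverts (?H s t)" for x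
      using inj that by (rule inj_on_image_mem_iff) (auto simp: V)
    have C: "?C \<in> pverts (?H s t)" by (simp add: V)
    have "is_clique_with_satellite G ?A ?B (g ?C)"
      unfolding is_clique_with_satellite_def
    proof (intro conjI)
      show "?A \<noteq> {}" "?B \<noteq> {}" using st by (auto simp: lessThan_empty_iff bot_nat_def)
      have "g ` (Inl ` {..<s} \<inter> Inr ` Inl ` {..<t}) = ?A \<inter> ?B"
        using inj by (rule inj_on_image_Int) (auto simp: V)
      then show "?A \<inter> ?B = {}" by auto
      show "g ?C \<notin> ?A \<union> ?B" using A[OF C] B[OF C] by auto
      show "pverts G = insert (g ?C) (?A \<union> ?B)" unfolding img V by (simp add: image_Un)
      show "\<forall>u\<in>pverts G. \<forall>v\<in>pverts G. (u, v) \<in> parcs G \<longleftrightarrow>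
          u \<noteq> v \<and> (u \<in> ?A \<or> v \<in> ?A \<or> u \<noteq> g ?C \<and> v \<noteq> g ?C)"
        unfolding img ball_simps using arc inj_on_eq_iff[OF inj] A C E by simp
    qed
    then show "\<exists>A B c. is_clique_with_satellite G A B c" by blast
  next
    fix A B c assume AB: "is_clique_with_satellite G A B c"
    then have fin: "finite A" "finite B" and disj: "A \<inter> B = {}" "c \<notin> A" "c \<notin> B"
      and un: "pverts G = insert c (A \<union> B)"
      using pair_graphD(1)[OF assms] by (auto simp: is_clique_with_satellite_def)
    obtain gA where gA: "inj_on gA {..<card A}" "gA ` {..<card A} = A"
      using fin(1) by (rule ex_inj_on_lessThan)
    obtain gB where gB: "inj_on gB {..<card B}" "gB ` {..<card B} = B"
      using fin(2) by (rule ex_inj_on_lessThan)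
    let ?V = "pverts (?H (card A) (card B))"
    \<comment> \<open>The constant branch is injective here, because the innermost summand
      contributes only the vertex \<open>?C\<close>.\<close>
    let ?g = "case_sum gA (case_sum gB (\<lambda>_. c))"
    have img: "?g ` Inl ` {..<card A} = A" "?g ` Inr ` Inl ` {..<card B} = B"
      using gA(2) gB(2) by (simp_all add: image_image)
    have inj: "inj_on ?g ?V"
    proof -
      have "inj_on ?g (Inl ` {..<card A})" "inj_on ?g (Inr ` Inl ` {..<card B})"
        using gA(1) gB(1) by (auto simp: inj_on_def)
      moreover have "?g ` Inl ` {..<card A} \<inter> ?g ` Inr ` Inl ` {..<card B} = {}"
        unfolding img by (rule disj(1))
      ultimately have "inj_on ?g (Inl ` {..<card A} \<union> Inr ` Inl ` {..<card B})"
        unfolding inj_on_Un by blast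
      moreover have "?g ?C \<notin> ?g ` (Inl ` {..<card A} \<union> Inr ` Inl ` {..<card B})"
        unfolding image_Un img using disj by simp
      ultimately show ?thesis
        unfolding V inj_on_insert by blast
    qed
    have A: "?g x \<in> A \<longleftrightarrow> x \<in> Inl ` {..<card A}" if "x \<in> ?V" for x
    proof -
      have "Inl ` {..<card A} \<subseteq> ?V" by (auto simp: V)
      then show ?thesis using inj_on_image_mem_iff[OF inj that] img(1) by metis
    qed
    have C: "?g x = c \<longleftrightarrow> x = ?C" if "x \<in> ?V" for x
      using inj_on_eq_iff[OF inj that, of ?C] by (simp add: V)
    have "?g ` ?V = pverts G"
      unfolding V image_insert image_Un img un by simp
    with inj have bij: "bij_betw ?g ?V (pverts G)" by (rule bij_betw_imageI)
    have "\<forall>x\<in>?V. \<forall>y\<in>?V. (x, y) \<in> parcs (?H (card A) (card B)) \<longleftrightarrow>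
      (?g x, ?g y) \<in> parcs G"
    proof (intro ballI)
      fix x y assume x: "x \<in> ?V" and y: "y \<in> ?V"
      have "(?g x, ?g y) \<in> parcs G \<longleftrightarrow>
          ?g x \<noteq> ?g y \<and> (?g x \<in> A \<or> ?g y \<in> A \<or> ?g x \<noteq> c \<and> ?g y \<noteq> c)"
        using AB bij_betwE[OF bij] x y unfolding is_clique_with_satellite_def by blast
      then show "(x, y) \<in> parcs (?H (card A) (card B)) \<longleftrightarrow> (?g x, ?g y) \<in> parcs G"
        using E[OF x y] inj_on_eq_iff[OF inj x y] A[OF x] A[OF y] C[OF x] C[OF y] by simp
    qed
    moreover have "1 \<le> card A" "1 \<le> card B"
      using AB fin by (auto simp: is_clique_with_satellite_def Suc_le_eq card_gt_0_iff One_nat_def)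
    ultimately show "\<exists>s t. 1 \<le> s \<and> 1 \<le> t \<and> (\<exists>g. bij_betw g (pverts (?H s t)) (pverts G) \<and>
        (\<forall>x\<in>pverts (?H s t). \<forall>y\<in>pverts (?H s t).
          (x, y) \<in> parcs (?H s t) \<longleftrightarrow> (g x, g y) \<in> parcs G))"
      using bij by blast
  qed
qed

section \<open>Twin classes\<close>

lemma twinsD:
  "twins G u v \<Longrightarrow> w \<in> pverts G \<Longrightarrow> w \<noteq> u \<Longrightarrow> w \<noteq> v \<Longrightarrow>
    (u, w) \<in> parcs G \<longleftrightarrow> (v, w) \<in> parcs G"
  by (auto simp: twins_def separates_def)

lemma twins_butD:
  "twins_but G z u v \<Longrightarrow> w \<in> pverts G \<Longrightarrow> w \<noteq> u \<Longrightarrow> w \<noteq> v \<Longrightarrow> w \<noteq> z \<Longrightarrow>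
    (u, w) \<in> parcs G \<longleftrightarrow> (v, w) \<in> parcs G"
  by (auto simp: twins_but_def separates_def)

text \<open>Some vertex separates a pair of non-twins, and only \<open>z\<close> can.\<close>

lemma separates_of_twins_but:
  assumes "twins_but G z u v" "\<not> twins G u v"
  shows "(u, z) \<in> parcs G \<longleftrightarrow> (v, z) \<notin> parcs G"
  using assms by (auto simp: twins_but_def twins_def separates_def)

lemma twins_but_commute: "twins_but G z u v \<longleftrightarrow> twins_but G z v u"
  by (simp add: twins_but_def separates_commute)

text \<open>A fifth vertex \<open>v\<close> would be adjacent to all four path vertices or to none.
  Then \<open>v\<close>, \<open>b\<close> and \<open>c\<close> show three different patterns on
  \<open>a\<close> and \<open>d\<close>, so no two of them agree there as degeneracy
  demands.\<close>

lemma induced_path4_spanning: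
  assumes G: "pair_graph G" and deg: "degenerate_triples G"
    and V: "{a, b, c, d} \<subseteq> pverts G" and dist: "distinct [a, b, c, d]"
    and P: "(a, b) \<in> parcs G" "(b, c) \<in> parcs G" "(c, d) \<in> parcs G"
      "(a, c) \<notin> parcs G" "(a, d) \<notin> parcs G" "(b, d) \<notin> parcs G"
  shows "is_path4 G a b c d"
proof -
  note s = pair_graph_arc_commute[OF G]
  have "v \<in> {a, b, c, d}" if v: "v \<in> pverts G" for v
  proof (rule ccontr)
    assume out: "v \<notin> {a, b, c, d}"
    let ?E = "\<lambda>x y. (x, y) \<in> parcs G"
    \<comment> \<open>Degeneracy in weakened form: some two members of a triple agree at both of two
      given vertices outside it.\<close>
    have D: "(?E x p = ?E y p \<and> ?E x q = ?E y q) \<or> (?E x p = ?E z p \<and> ?E x q = ?E z q) \<or>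
        (?E y p = ?E z p \<and> ?E y q = ?E z q)"
      if "{x, y, z, p, q} \<subseteq> pverts G" "distinct [x, y, z, p, q]" for x y z p q
    proof -
      have "twins_but G z x y \<or> twins_but G y x z \<or> twins_but G x y z"
        using deg that unfolding degenerate_triples_def by auto
      then show ?thesis
        using that twins_butD[of G z x y] twins_butD[of G y x z] twins_butD[of G x y z] by auto
    qed
    have "v \<noteq> a" "v \<noteq> b" "v \<noteq> c" "v \<noteq> d" using out by auto
    \<comment> \<open>In the triples \<open>a b c\<close>, \<open>b c d\<close> and
      \<open>a b d\<close>, the remaining path vertex \<open>d\<close>, \<open>a\<close> or
      \<open>c\<close> sees exactly one pair alike, so this pair must also agree at
      \<open>v\<close>.\<close>
    then have "?E a v = ?E b v" "?E b v = ?E d v" "?E c v = ?E d v"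
      using D[of a b c d v] D[of b c d a v] D[of a b d c v] V dist v P
        s[of b a] s[of c b] s[of d c] s[of c a] s[of d a] s[of d b] by auto
    then show False
      using D[of v b c a d] D[of v a d b c] V dist v P \<open>v \<noteq> a\<close> \<open>v \<noteq> b\<close> \<open>v \<noteq> c\<close> \<open>v \<noteq> d\<close>
        s[of b a] s[of c b] s[of d c] s[of c a] s[of d a] s[of d b]
        s[of v a] s[of v b] s[of v c] s[of v d] by auto
  qed
  then show ?thesis using V dist P unfolding is_path4_def by blast
qed

text \<open>Degeneracy of the four triples forces an induced path: no triple is a triangle or
  independent, since its third member separates a pair, and the agreement of that pair at the fourth
  vertex excludes the four-cycle and its complement. The path then spans the graph.\<close>

lemma four_nontwins:
  assumes G: "pair_graph G" and deg: "degenerate_triples G"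
    and V: "{x, y, z, w} \<subseteq> pverts G"
    and nt: "\<not> twins G x y" "\<not> twins G x z" "\<not> twins G x w" "\<not> twins G y z" "\<not> twins G y w"
      "\<not> twins G z w"
  shows "\<exists>a b c d. is_path4 G a b c d"
proof -
  note s = pair_graph_arc_commute[OF G]
  let ?E = "\<lambda>x y. (x, y) \<in> parcs G"
  let ?P = "\<lambda>a b c d. ?E a b \<and> ?E b c \<and> ?E c d \<and> \<not> ?E a c \<and> \<not> ?E a d \<and> \<not> ?E b d"
  have dist: "distinct [x, y, z, w]" using nt twins_refl[of G] by auto
  \<comment> \<open>As no two members of the triple are twins, its degenerate pair is separated by
    the third member, and by no other vertex, in particular not by \<open>w\<close>.\<close>
  have T: "(?E x z \<noteq> ?E y z \<and> ?E x w = ?E y w) \<or> (?E x y \<noteq> ?E z y \<and> ?E x w = ?E z w) \<or>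
      (?E y x \<noteq> ?E z x \<and> ?E y w = ?E z w)"
    if "{x, y, z, w} \<subseteq> pverts G" "distinct [x, y, z, w]"
      "\<not> twins G x y" "\<not> twins G x z" "\<not> twins G y z" for x y z w
  proof -
    have "twins_but G z x y \<or> twins_but G y x z \<or> twins_but G x y z"
      using deg that unfolding degenerate_triples_def by auto
    then show ?thesis
      using that twins_butD[of G z x y w] twins_butD[of G y x z w] twins_butD[of G x y z w]
        separates_of_twins_but[of G z x y] separates_of_twins_but[of G y x z]
        separates_of_twins_but[of G x y z] by auto
  qed
  \<comment> \<open>The orderings of the four vertices up to reversal, one for each of the twelve
    labelled paths.\<close>
  have cases: "?P x y z w \<or> ?P x y w z \<or> ?P x z y w \<or> ?P x z w y \<or> ?P x w y z \<or> ?P x w z y \<or>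
      ?P y x z w \<or> ?P y x w z \<or> ?P y z x w \<or> ?P y w x z \<or> ?P z x y w \<or> ?P z y x w"
    using T[of x y z w] T[of x y w z] T[of x z w y] T[of y z w x] V dist nt
      s[of y x] s[of z x] s[of w x] s[of z y] s[of w y] s[of w z]
    by simp argo
  have path: "\<exists>a b c d. is_path4 G a b c d"
    if "?P a b c d" "{a, b, c, d} \<subseteq> pverts G" "distinct [a, b, c, d]" for a b c d
    using induced_path4_spanning[OF G deg that(2,3)] that(1) by blast
  show ?thesis
    by (insert cases, elim disjE; erule path; use V dist in auto)
qed

text \<open>With \<open>z\<close> the sole separator of \<open>x\<close> and \<open>y\<close>, the
  class of \<open>z\<close> is a singleton. The classes \<open>A\<close> of \<open>x\<close> and
  \<open>B\<close> of \<open>y\<close> are cliques joined to each other, and \<open>z\<close> is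
  joined to \<open>A\<close> only, so \<open>z\<close> is the satellite.\<close>

lemma three_nontwins_adjacent:
  assumes G: "pair_graph G" and V: "x \<in> pverts G" "y \<in> pverts G" "z \<in> pverts G"
    and nt: "\<not> twins G x y" "\<not> twins G x z" "\<not> twins G y z"
    and cover: "\<And>u. u \<in> pverts G \<Longrightarrow> twins G u x \<or> twins G u y \<or> twins G u z"
    and but: "twins_but G z x y"
    and arcs: "(x, y) \<in> parcs G" "(x, z) \<in> parcs G" "(y, z) \<notin> parcs G"
  shows "\<exists>A B c. is_clique_with_satellite G A B c"
proof -
  note s = pair_graph_arc_commute[OF G] and loop = pair_graph_no_loop[OF G]
  have ne: "x \<noteq> y" "x \<noteq> z" "y \<noteq> z" using nt twins_refl[of G] by auto
  define A where "A = {u \<in> pverts G. twins G u x}"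
  define B where "B = {u \<in> pverts G. twins G u y}"
  have disj: "A \<inter> B = {}"
    using nt(1) V twins_trans[OF G, of x _ y] by (auto simp: A_def B_def dest: twins_sym)
  have zA: "z \<notin> A" and zB: "z \<notin> B"
    using nt by (auto simp: A_def B_def dest: twins_sym)
  have xA: "x \<in> A" and yB: "y \<in> B" using V by (simp_all add: A_def B_def twins_refl)
  have AV: "u \<in> pverts G" and Ax: "twins G u x" if "u \<in> A" for u using that by (auto simp: A_def)
  have BV: "u \<in> pverts G" and By: "twins G u y" if "u \<in> B" for u using that by (auto simp: B_def)
  \<comment> \<open>Another twin of \<open>z\<close> would, like \<open>z\<close>, be adjacent to
    \<open>x\<close> and not to \<open>y\<close>, and so be a second separator.\<close>
  have z_only: "u = z" if u: "u \<in> pverts G" "twins G u z" for u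
  proof (rule ccontr)
    assume "u \<noteq> z"
    have "u \<noteq> x" "u \<noteq> y" using u nt by auto
    then have "(u, x) \<in> parcs G" "(u, y) \<notin> parcs G"
      using twinsD[OF u(2), of x] twinsD[OF u(2), of y] V ne arcs s[of z] by auto
    then show False
      using twins_butD[OF but u(1)] \<open>u \<noteq> x\<close> \<open>u \<noteq> y\<close> \<open>u \<noteq> z\<close> s[of u] by auto
  qed
  have un: "pverts G = insert z (A \<union> B)"
    using cover z_only V by (auto simp: A_def B_def)
  have Ay: "(u, y) \<in> parcs G" if "u \<in> A" for u
    using twinsD[OF Ax[OF that], of y] that yB disj V ne arcs by auto
  have Bx: "(u, x) \<in> parcs G" if "u \<in> B" for u
    using twinsD[OF By[OF that], of x] that xA disj V ne arcs s[of y x] by auto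
  \<comment> \<open>As \<open>u\<close> is adjacent to \<open>y\<close> and does not separate
    \<open>x\<close> from \<open>y\<close>, it is adjacent to \<open>x\<close> as well.\<close>
  have Ax': "(u, x) \<in> parcs G" if "u \<in> A" "u \<noteq> x" for u
    using twins_butD[OF but AV[OF that(1)]] that yB disj zA Ay[OF that(1)] s[of u] by auto
  have By': "(u, y) \<in> parcs G" if "u \<in> B" "u \<noteq> y" for u
    using twins_butD[OF but BV[OF that(1)]] that xA disj zB Bx[OF that(1)] s[of u] by auto
  have AA: "(u, v) \<in> parcs G" if "u \<in> A" "v \<in> A" "u \<noteq> v" for u v
    using twinsD[OF Ax[OF that(1)] AV[OF that(2)]] that Ax' s[of x v] by metis
  have BB: "(u, v) \<in> parcs G" if "u \<in> B" "v \<in> B" "u \<noteq> v" for u v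
    using twinsD[OF By[OF that(1)] BV[OF that(2)]] that By' s[of y v] by metis
  have AB: "(u, v) \<in> parcs G" if "u \<in> A" "v \<in> B" for u v
  proof -
    have "v \<noteq> u" "v \<noteq> x" using that disj xA by auto
    then show ?thesis
      using twinsD[OF Ax[OF that(1)] BV[OF that(2)]] Bx[OF that(2)] s[of x v] by auto
  qed
  have Az: "(u, z) \<in> parcs G" if "u \<in> A" for u
    using twinsD[OF Ax[OF that], of z] that zA V ne arcs by auto
  have Bz: "(u, z) \<notin> parcs G" if "u \<in> B" for u
    using twinsD[OF By[OF that], of z] that zB V ne arcs by auto
  have "is_clique_with_satellite G A B z"
    unfolding is_clique_with_satellite_def
  proof (intro conjI ballI)
    fix u v assume "u \<in> pverts G" "v \<in> pverts G"
    then have "u = z \<or> u \<in> A \<or> u \<in> B" "v = z \<or> v \<in> A \<or> v \<in> B" using un by auto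
    then show "(u, v) \<in> parcs G \<longleftrightarrow> u \<noteq> v \<and> (u \<in> A \<or> v \<in> A \<or> u \<noteq> z \<and> v \<noteq> z)"
      using AA BB AB Az Bz s zA zB disj loop by (elim disjE) (blast | metis)+
  qed (use xA yB disj zA zB un in auto)
  then show ?thesis by blast
qed

text \<open>Degeneracy picks a pair with a single separator. Up to renaming it is \<open>x\<close>,
  \<open>y\<close> with separator \<open>z\<close>, adjacent to \<open>x\<close> but not to
  \<open>y\<close>. If \<open>x\<close> and \<open>y\<close> are not adjacent, the complement has
  the required form with \<open>x\<close> and \<open>y\<close> exchanged.\<close>

lemma three_nontwins:
  assumes G: "pair_graph G" and deg: "degenerate_triples G"
    and V: "x \<in> pverts G" "y \<in> pverts G" "z \<in> pverts G"
    and nt: "\<not> twins G x y" "\<not> twins G x z" "\<not> twins G y z"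
    and cover: "\<And>u. u \<in> pverts G \<Longrightarrow> twins G u x \<or> twins G u y \<or> twins G u z"
  shows "\<exists>H\<in>{G, graph_complement G}. \<exists>A B c. is_clique_with_satellite H A B c"
proof -
  note s = pair_graph_arc_commute[OF G]
  let ?C = "graph_complement G"
  have main: "\<exists>H\<in>{G, ?C}. \<exists>A B c. is_clique_with_satellite H A B c"
    if V: "x \<in> pverts G" "y \<in> pverts G" "z \<in> pverts G"
      and nt: "\<not> twins G x y" "\<not> twins G x z" "\<not> twins G y z"
      and cover: "\<And>u. u \<in> pverts G \<Longrightarrow> twins G u x \<or> twins G u y \<or> twins G u z"
      and but: "twins_but G z x y" and arcs: "(x, z) \<in> parcs G" "(y, z) \<notin> parcs G" for x y z
  proof (cases "(x, y) \<in> parcs G")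
    case True
    then show ?thesis using three_nontwins_adjacent[OF G V nt cover but _ arcs] by blast
  next
    case False
    have ne: "x \<noteq> y" "x \<noteq> z" "y \<noteq> z" using nt twins_refl[of G] by auto
    have "\<exists>A B c. is_clique_with_satellite ?C A B c"
    proof (rule three_nontwins_adjacent[of _ y x z])
      show "pair_graph ?C" using G by (rule pair_graph_complement)
      show "\<not> twins ?C y x" "\<not> twins ?C y z" "\<not> twins ?C x z"
        using nt V by (auto simp: twins_complement dest: twins_sym)
      show "twins ?C u y \<or> twins ?C u x \<or> twins ?C u z" if "u \<in> pverts ?C" for u
        using cover[of u] that V by (auto simp: twins_complement)
      show "twins_but ?C z y x"
        using but V by (simp add: twins_but_def separates_complement separates_commute)
      show "(y, x) \<in> parcs ?C" "(y, z) \<in> parcs ?C" "(x, z) \<notin> parcs ?C"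
        using False arcs V ne s[of y x] by (auto simp: graph_complement_def)
    qed (use V in simp_all)
    then show ?thesis by blast
  qed
  \<comment> \<open>Frees \<open>main\<close> from the choice of which of \<open>x\<close> and
    \<open>y\<close> is adjacent to \<open>z\<close>.\<close>
  have swap: "\<exists>H\<in>{G, ?C}. \<exists>A B c. is_clique_with_satellite H A B c"
    if V: "x \<in> pverts G" "y \<in> pverts G" "z \<in> pverts G"
      and nt: "\<not> twins G x y" "\<not> twins G x z" "\<not> twins G y z"
      and cover: "\<And>u. u \<in> pverts G \<Longrightarrow> twins G u x \<or> twins G u y \<or> twins G u z"
      and but: "twins_but G z x y" for x y z
  proof (cases "(x, z) \<in> parcs G")
    case True
    then show ?thesis
      using separates_of_twins_but[OF but nt(1)] by (intro main[of x y z]) (use that in auto)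
  next
    case False
    then show ?thesis
      using separates_of_twins_but[OF but nt(1)]
      by (intro main[of y x z]) (use that twins_sym[of G] twins_but_commute[of G] in blast)+
  qed
  have ne: "x \<noteq> y" "x \<noteq> z" "y \<noteq> z" using nt twins_refl[of G] by auto
  then consider "twins_but G z x y" | "twins_but G y x z" | "twins_but G x y z"
    using deg V unfolding degenerate_triples_def by blast
  then show ?thesis
  proof cases
    case 1 then show ?thesis by (intro swap[of x y z]) (use V nt cover in blast)+
  next
    case 2 then show ?thesis
      by (intro swap[of x z y]) (use V nt cover twins_sym[of G] in blast)+
  next
    case 3 then show ?thesis
      by (intro swap[of y z x]) (use V nt cover twins_sym[of G] in blast)+
  qed
qed

section \<open>Two twin classes and the classification\<close>

definition exceptional :: "'a pair_pre_digraph \<Rightarrow> bool" where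
  "exceptional G \<longleftrightarrow> (\<exists>a b c d. is_path4 G a b c d) \<or> (\<exists>A B. is_biclique G A B) \<or>
     (\<exists>A B. is_complete_split G A B) \<or> (\<exists>A B c. is_clique_with_satellite G A B c)"

text \<open>An arc inside a twin class is moved by replacing one endpoint at a time by a twin: from
  \<open>(p, q)\<close> to \<open>(p, v)\<close> to \<open>(u, v)\<close>. When \<open>v = p\<close>
  the middle pair collapses, and \<open>(p, u)\<close> reversed is the goal.\<close>

lemma twins_class_homogeneous:
  assumes G: "pair_graph G" and A: "A \<subseteq> pverts G" "\<And>u v. u \<in> A \<Longrightarrow> v \<in> A \<Longrightarrow> twins G u v"
    and pq: "p \<in> A" "q \<in> A" "(p, q) \<in> parcs G" and uv: "u \<in> A" "v \<in> A" "u \<noteq> v"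
  shows "(u, v) \<in> parcs G"
proof -
  note s = pair_graph_arc_commute[OF G]
  have ne: "p \<noteq> q" using pq pair_graph_no_loop[OF G] by auto
  have p: "(p, r) \<in> parcs G" if "r \<in> A" "r \<noteq> p" for r
  proof (cases "r = q")
    case False
    then show ?thesis
      using twinsD[OF A(2)[OF that(1) pq(2)], of p] that pq ne A(1) s[of p] by auto
  qed (use pq in simp)
  show ?thesis
  proof (cases "v = p")
    case True
    then show ?thesis using p[of u] uv s[of p] by auto
  next
    case False
    then show ?thesis
      using twinsD[OF A(2)[OF uv(1) pq(1)], of v] p[of v] uv A(1) by auto
  qed
qed

text \<open>All arcs between the classes \<open>A\<close> and \<open>B\<close> are present, and each
  class is a clique or independent. Two independent classes give a biclique; a clique and an
  independent class with a second vertex give a complete split graph. Otherwise the graph is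
  complete, and \<open>x\<close> and \<open>y\<close> would be twins.\<close>

lemma two_twin_classes:
  assumes G: "pair_graph G" and V: "x \<in> pverts G" "y \<in> pverts G"
    and nt: "\<not> twins G x y" and xy: "(x, y) \<in> parcs G"
    and cover: "\<And>u. u \<in> pverts G \<Longrightarrow> twins G u x \<or> twins G u y"
  shows "exceptional G"
proof -
  note s = pair_graph_arc_commute[OF G] and loop = pair_graph_no_loop[OF G]
  define A where "A = {u \<in> pverts G. twins G u x}"
  define B where "B = {u \<in> pverts G. twins G u y}"
  have sub: "A \<subseteq> pverts G" "B \<subseteq> pverts G" by (auto simp: A_def B_def)
  have un: "pverts G = A \<union> B" using cover by (auto simp: A_def B_def)
  have disj: "A \<inter> B = {}"
    using nt V twins_trans[OF G, of x _ y] by (auto simp: A_def B_def dest: twins_sym)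
  have xA: "x \<in> A" and yB: "y \<in> B" using V by (simp_all add: A_def B_def twins_refl)
  have tA: "twins G u v" if "u \<in> A" "v \<in> A" for u v
    using that twins_trans[OF G, of u x v] V by (auto simp: A_def dest: twins_sym)
  have tB: "twins G u v" if "u \<in> B" "v \<in> B" for u v
    using that twins_trans[OF G, of u y v] V by (auto simp: B_def dest: twins_sym)
  have Ay: "(u, y) \<in> parcs G" if "u \<in> A" for u
    using twinsD[OF tA[OF that xA] V(2)] that xA yB disj xy by auto
  have AB: "(u, v) \<in> parcs G" if "u \<in> A" "v \<in> B" for u v
    using twinsD[OF tB[OF that(2) yB], of u] that yB disj Ay[of u] sub s[of u] by auto
  have BA: "(v, u) \<in> parcs G" if "u \<in> A" "v \<in> B" for u v
    using AB[OF that] s by blast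
  have fin: "finite (pverts G)" using pair_graphD(1)[OF G] .
  have joint: "twins G x y"
    if "\<And>w. w \<in> pverts G \<Longrightarrow> w \<noteq> x \<Longrightarrow> w \<noteq> y \<Longrightarrow> (x, w) \<in> parcs G \<and> (y, w) \<in> parcs G"
    using that by (auto simp: twins_def separates_def)
  \<comment> \<open>Stated for both orders of the classes, since either may be the independent one;
    \<open>p\<close> and \<open>q\<close> give it size at least 2.\<close>
  have split: "is_complete_split G A' B'"
    if "A' = A \<and> B' = B \<or> A' = B \<and> B' = A"
      and clique: "\<And>u v. u \<in> A' \<Longrightarrow> v \<in> A' \<Longrightarrow> u \<noteq> v \<Longrightarrow> (u, v) \<in> parcs G"
      and indep: "\<And>u v. u \<in> B' \<Longrightarrow> v \<in> B' \<Longrightarrow> (u, v) \<notin> parcs G"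
      and pq: "p \<in> B'" "q \<in> B'" "p \<noteq> q" for A' B' p q
  proof -
    have A'B': "A' \<inter> B' = {}" "pverts G = A' \<union> B'" "A' \<noteq> {}"
      "\<And>u v. u \<in> A' \<Longrightarrow> v \<in> B' \<Longrightarrow> (u, v) \<in> parcs G \<and> (v, u) \<in> parcs G"
      using that(1) disj un xA yB AB BA by blast+
    have "finite B'" using fin A'B'(2) by simp
    then have "card {p, q} \<le> card B'" using pq by (intro card_mono) auto
    then have "2 \<le> card B'" using pq by simp
    show ?thesis
      unfolding is_complete_split_def
    proof (intro conjI ballI)
      fix u v assume "u \<in> pverts G" "v \<in> pverts G"
      then have "u \<in> A' \<or> u \<in> B'" "v \<in> A' \<or> v \<in> B'" using A'B'(2) by auto
      then show "(u, v) \<in> parcs G \<longleftrightarrow> u \<noteq> v \<and> (u \<in> A' \<or> v \<in> A')"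
        using A'B'(1) A'B'(4)[of u v] A'B'(4)[of v u] clique[of u v] indep[of u v] loop[of u]
        by (elim disjE) auto
    qed (fact A'B' \<open>2 \<le> card B'\<close>)+
  qed
  show ?thesis
  proof (cases "\<exists>p\<in>A. \<exists>q\<in>A. (p, q) \<in> parcs G"; cases "\<exists>p\<in>B. \<exists>q\<in>B. (p, q) \<in> parcs G")
    assume "\<not> (\<exists>p\<in>A. \<exists>q\<in>A. (p, q) \<in> parcs G)" "\<not> (\<exists>p\<in>B. \<exists>q\<in>B. (p, q) \<in> parcs G)"
    then have indep: "(u, v) \<notin> parcs G" if "u \<in> A \<and> v \<in> A \<or> u \<in> B \<and> v \<in> B" for u v
      using that by blast
    have "(u, v) \<in> parcs G \<longleftrightarrow> (u \<in> A) \<noteq> (v \<in> A)"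
      if "u \<in> pverts G" "v \<in> pverts G" for u v
      using that disj un AB[of u v] BA[of v u] indep[of u v] by auto
    then have "is_biclique G A B"
      using disj un xA yB unfolding is_biclique_def by auto
    then show ?thesis unfolding exceptional_def by blast
  next
    assume "\<exists>p\<in>A. \<exists>q\<in>A. (p, q) \<in> parcs G" and B: "\<not> (\<exists>p\<in>B. \<exists>q\<in>B. (p, q) \<in> parcs G)"
    then have A: "(u, v) \<in> parcs G" if "u \<in> A" "v \<in> A" "u \<noteq> v" for u v
      using twins_class_homogeneous[OF G sub(1) tA] that by blast
    show ?thesis
    proof (cases "\<exists>p\<in>B. p \<noteq> y")
      case True
      then have "is_complete_split G A B" using split[of A B _ y] A B yB by blast
      then show ?thesis unfolding exceptional_def by blast
    next
      case False
      have "twins G x y"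
        using un A[OF xA] BA[OF _ yB] False by (intro joint) auto
      then show ?thesis using nt by simp
    qed
  next
    assume A: "\<not> (\<exists>p\<in>A. \<exists>q\<in>A. (p, q) \<in> parcs G)" and "\<exists>p\<in>B. \<exists>q\<in>B. (p, q) \<in> parcs G"
    then have B: "(u, v) \<in> parcs G" if "u \<in> B" "v \<in> B" "u \<noteq> v" for u v
      using twins_class_homogeneous[OF G sub(2) tB] that by blast
    show ?thesis
    proof (cases "\<exists>p\<in>A. p \<noteq> x")
      case True
      then have "is_complete_split G B A" using split[of B A _ x] A B xA by blast
      then show ?thesis unfolding exceptional_def by blast
    next
      case False
      have "twins G x y"
        using un B[OF yB] AB[OF xA] False by (intro joint) auto
      then show ?thesis using nt by simp
    qed
  next
    assume "\<exists>p\<in>A. \<exists>q\<in>A. (p, q) \<in> parcs G" "\<exists>p\<in>B. \<exists>q\<in>B. (p, q) \<in> parcs G"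
    then obtain p q r t where pq: "p \<in> A" "q \<in> A" "(p, q) \<in> parcs G"
      and rt: "r \<in> B" "t \<in> B" "(r, t) \<in> parcs G" by blast
    have "(u, v) \<in> parcs G" if "u \<in> pverts G" "v \<in> pverts G" "u \<noteq> v" for u v
    proof -
      have "u \<in> A \<or> u \<in> B" "v \<in> A \<or> v \<in> B" using that un by auto
      then consider "u \<in> A" "v \<in> A" | "u \<in> A" "v \<in> B" | "u \<in> B" "v \<in> A" | "u \<in> B" "v \<in> B"
        by blast
      then show ?thesis
      proof cases
        case 1
        then show ?thesis
          using twins_class_homogeneous[OF G sub(1) tA pq] \<open>u \<noteq> v\<close> by simp
      next
        case 4
        then show ?thesis
          using twins_class_homogeneous[OF G sub(2) tB rt] \<open>u \<noteq> v\<close> by simp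
      qed (simp_all add: AB BA)
    qed
    then have "twins G x y" using V by (intro joint) auto
    then show ?thesis using nt by simp
  qed
qed

text \<open>Representatives of different twin classes are chosen one after another; two, three and
  at least four classes are treated in turn. With two classes, passing to the complement if
  necessary makes the representatives adjacent.\<close>

lemma exceptional_of_degenerate_triples:
  assumes G: "pair_graph G" and V: "x \<in> pverts G" "y \<in> pverts G" and nt: "\<not> twins G x y"
    and deg: "degenerate_triples G"
  shows "exceptional G \<or> exceptional (graph_complement G)"
proof (cases "\<forall>u\<in>pverts G. twins G u x \<or> twins G u y")
  case True
  show ?thesis
  proof (cases "(x, y) \<in> parcs G")
    case True
    then show ?thesis
      using two_twin_classes[OF G V nt] \<open>\<forall>u\<in>pverts G. twins G u x \<or> twins G u y\<close> by blast
  next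
    case False
    have "x \<noteq> y" using nt twins_refl[of G] by auto
    then have "(x, y) \<in> parcs (graph_complement G)"
      using False V by (simp add: graph_complement_def)
    then have "exceptional (graph_complement G)"
      using True V nt by (intro two_twin_classes[of _ x y] pair_graph_complement[OF G])
        (simp_all add: twins_complement)
    then show ?thesis ..
  qed
next
  case False
  then obtain z where z: "z \<in> pverts G" and "\<not> twins G z x" "\<not> twins G z y" by blast
  then have ntz: "\<not> twins G x z" "\<not> twins G y z" by (auto dest: twins_sym)
  show ?thesis
  proof (cases "\<forall>u\<in>pverts G. twins G u x \<or> twins G u y \<or> twins G u z")
    case True
    then have "\<exists>H\<in>{G, graph_complement G}. \<exists>A B c. is_clique_with_satellite H A B c"
      by (intro three_nontwins[OF G deg V z nt ntz]) blast
    then show ?thesis unfolding exceptional_def by blast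
  next
    case False
    then obtain w where w: "w \<in> pverts G" "\<not> twins G w x" "\<not> twins G w y" "\<not> twins G w z"
      by blast
    then have "\<not> twins G x w" "\<not> twins G y w" "\<not> twins G z w" by (auto dest: twins_sym)
    then have "\<exists>a b c d. is_path4 G a b c d"
      using four_nontwins[OF G deg, of x y z w] V z w nt ntz by simp
    then show ?thesis unfolding exceptional_def by blast
  qed
qed

section \<open>Degeneracy of the exceptional graphs and the final equivalence\<close>

lemma twins_but_if_twins: "twins G x y \<Longrightarrow> twins_but G z x y"
  by (simp add: twins_def twins_but_def)

text \<open>In bicliques and complete split graphs two sets of mutual twins cover the vertices, so
  every triple contains twins. Order at least 3 keeps out \<open>K_{1,1}\<close>, a biclique whose
  vertices are twins.\<close>

lemma degenerate_triples_if_exceptional: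
  assumes G: "pair_graph G" and card: "3 \<le> card (pverts G)" and ex: "exceptional G"
  shows "(\<exists>u\<in>pverts G. \<exists>v\<in>pverts G. \<not> twins G u v) \<and> degenerate_triples G"
proof -
  note s = pair_graph_arc_commute[OF G] and loop = pair_graph_no_loop[OF G]
  consider (path4) a b c d where "is_path4 G a b c d" | (biclique) A B where "is_biclique G A B"
    | (split) A B where "is_complete_split G A B"
    | (satellite) A B c where "is_clique_with_satellite G A B c"
    using ex unfolding exceptional_def by blast
  then show ?thesis
  proof cases
    case path4
    then have "\<not> twins G a b" by (auto simp: twins_def separates_def is_path4_def)
    moreover have "degenerate_triples G"
      using path4 loop s[of b a] s[of c b] s[of d c] s[of c a] s[of d a] s[of d b]
      by (simp add: degenerate_triples_def twins_but_def separates_def is_path4_def)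
    ultimately show ?thesis using path4 unfolding is_path4_def by blast
  next
    case biclique
    then have V: "pverts G = A \<union> B" and disj: "A \<inter> B = {}"
      and arc: "\<And>u v. u \<in> pverts G \<Longrightarrow> v \<in> pverts G \<Longrightarrow> (u, v) \<in> parcs G \<longleftrightarrow> (u \<in> A) \<noteq> (v \<in> A)"
      unfolding is_biclique_def by blast+
    obtain a b where ab: "a \<in> A" "b \<in> B" using biclique unfolding is_biclique_def by blast
    \<comment> \<open>A third vertex lies in exactly one part, so it is adjacent to exactly one of
      \<open>a\<close> and \<open>b\<close>.\<close>
    have "\<not> pverts G \<subseteq> {a, b}"
    proof
      assume "pverts G \<subseteq> {a, b}"
      then have "card (pverts G) \<le> card {a, b}" by (intro card_mono) auto
      then show False using card card_insert_le_m1[of 2 "{b}" a] by simp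
    qed
    then obtain w where "w \<in> pverts G" "w \<noteq> a" "w \<noteq> b" by blast
    then have nt: "\<not> twins G a b"
      using ab V disj arc by (auto simp: twins_def separates_def)
    have t: "twins G x y" if "x \<in> pverts G" "y \<in> pverts G" "x \<in> A \<longleftrightarrow> y \<in> A" for x y
      using that arc by (auto simp: twins_def separates_def)
    have "degenerate_triples G"
      unfolding degenerate_triples_def using twins_but_if_twins[OF t] by blast
    then show ?thesis using nt ab V by blast
  next
    case split
    then have V: "pverts G = A \<union> B" and disj: "A \<inter> B = {}"
      and arc: "\<And>u v. u \<in> pverts G \<Longrightarrow> v \<in> pverts G \<Longrightarrow>
        (u, v) \<in> parcs G \<longleftrightarrow> u \<noteq> v \<and> (u \<in> A \<or> v \<in> A)"
      unfolding is_complete_split_def by blast+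
    obtain a where a: "a \<in> A" using split unfolding is_complete_split_def by blast
    obtain b b' where b: "b \<in> B" "b' \<in> B" "b \<noteq> b'"
    proof -
      have "\<not> (\<forall>b\<in>B. \<forall>b'\<in>B. b = b')"
        using split card_le_Suc0_iff_eq[of B] V pair_graphD(1)[OF G]
        by (auto simp: is_complete_split_def)
      then show ?thesis using that by blast
    qed
    \<comment> \<open>The second vertex of \<open>B\<close> is the separator: adjacent to
      \<open>a\<close>, not to \<open>b\<close>.\<close>
    have "separates G b' a b" using a b V disj arc by (auto simp: separates_def)
    then have nt: "\<not> twins G a b"
      using b V unfolding twins_def by blast
    have t: "twins G x y" if "x \<in> pverts G" "y \<in> pverts G" "x \<in> A \<longleftrightarrow> y \<in> A" for x y
      using that arc by (auto simp: twins_def separates_def)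
    have "degenerate_triples G"
      unfolding degenerate_triples_def using twins_but_if_twins[OF t] by blast
    then show ?thesis using nt a b V by blast
  next
    case satellite
    then have V: "pverts G = insert c (A \<union> B)" and disj: "A \<inter> B = {}" "c \<notin> A" "c \<notin> B"
      and arc: "\<And>u v. u \<in> pverts G \<Longrightarrow> v \<in> pverts G \<Longrightarrow>
        (u, v) \<in> parcs G \<longleftrightarrow> u \<noteq> v \<and> (u \<in> A \<or> v \<in> A \<or> u \<noteq> c \<and> v \<noteq> c)"
      unfolding is_clique_with_satellite_def by blast+
    obtain a b where ab: "a \<in> A" "b \<in> B"
      using satellite unfolding is_clique_with_satellite_def by blast
    have "separates G c a b" using ab V disj arc by (auto simp: separates_def)
    then have nt: "\<not> twins G a b" using V unfolding twins_def by blast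
    have t: "twins_but G z x y"
      if "x \<in> pverts G" "y \<in> pverts G" "x \<in> A \<and> y \<in> A \<or> x \<notin> A \<and> y \<notin> A \<and> x \<noteq> c \<and> y \<noteq> c" for x y z
      using that arc by (auto simp: twins_but_def separates_def)
    \<comment> \<open>Vertices other than \<open>c\<close> lie in the clique
      \<open>A \<union> B\<close>, so only \<open>c\<close> can separate two of them.\<close>
    have t': "twins_but G c x y" if "x \<in> pverts G" "y \<in> pverts G" "x \<noteq> c" "y \<noteq> c" for x y
      using that arc by (auto simp: twins_but_def separates_def)
    have "degenerate_triples G"
      unfolding degenerate_triples_def
    proof (intro ballI impI)
      fix x y z assume x: "x \<in> pverts G" and y: "y \<in> pverts G" and z: "z \<in> pverts G"
        and ne: "x \<noteq> y" "x \<noteq> z" "y \<noteq> z"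
      show "twins_but G z x y \<or> twins_but G y x z \<or> twins_but G x y z"
      \<comment> \<open>If \<open>c\<close> is in the triple, the other two members are separated at
        most by \<open>c\<close>; if not, two members lie in the same one of \<open>A\<close> and
        \<open>B\<close>.\<close>
      proof (cases "c \<in> {x, y, z}")
        case True
        then show ?thesis using t'[of x y] t'[of x z] t'[of y z] x y z ne by auto
      next
        case False
        then show ?thesis using t[of x y] t[of x z] t[of y z] x y z by blast
      qed
    qed
    then show ?thesis using nt ab V by blast
  qed
qed

text \<open>Serves orders 0 and 1, where no graph may be exceptional.\<close>

lemma card_ge_2_if_exceptional:
  assumes G: "pair_graph G" and ex: "exceptional G"
  shows "2 \<le> card (pverts G)"
proof -
  have "\<exists>A B. A \<inter> B = {} \<and> A \<noteq> {} \<and> B \<noteq> {} \<and> A \<union> B \<subseteq> pverts G"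
  proof -
    consider (path4) a b c d where "is_path4 G a b c d" | (biclique) A B where "is_biclique G A B"
      | (split) A B where "is_complete_split G A B"
      | (satellite) A B c where "is_clique_with_satellite G A B c"
      using ex unfolding exceptional_def by blast
    then show ?thesis
    proof cases
      case path4
      then show ?thesis by (intro exI[of _ "{a}"] exI[of _ "{b}"]) (auto simp: is_path4_def)
    next
      case biclique
      then show ?thesis by (intro exI[of _ A] exI[of _ B]) (auto simp: is_biclique_def)
    next
      case split
      then show ?thesis by (intro exI[of _ A] exI[of _ B]) (auto simp: is_complete_split_def)
    next
      case satellite
      then show ?thesis
        by (intro exI[of _ A] exI[of _ B]) (auto simp: is_clique_with_satellite_def)
    qed
  qed
  then obtain A B where AB: "A \<inter> B = {}" "A \<noteq> {}" "B \<noteq> {}" "A \<union> B \<subseteq> pverts G" by blast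
  obtain u v where "u \<in> A" "v \<in> B" using AB by auto
  then have "u \<in> pverts G" "v \<in> pverts G" "u \<noteq> v" using AB by auto
  then have "\<not> card (pverts G) \<le> Suc 0"
    using card_le_Suc0_iff_eq[OF pair_graphD(1)[OF G]] by blast
  then show ?thesis by simp
qed

text \<open>From order 3 on, both sides amount to degenerate triples together with a pair of
  non-twins, a condition that \<open>G\<close> shares with its complement. For orders 0 and 1 both
  sides are false, the integer difference being negative.\<close>

lemma adj_dim_eq_iff_exceptional:
  assumes G: "pair_graph G" and two: "card (pverts G) \<noteq> 2"
  shows "int (adj_dim G) = int (card (pverts G)) - 2 \<longleftrightarrow>
    exceptional G \<or> exceptional (graph_complement G)"
proof (cases "3 \<le> card (pverts G)")
  case True
  let ?C = "graph_complement G"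
  let ?D = "\<lambda>G :: 'a pair_pre_digraph. (\<exists>u\<in>pverts G. \<exists>v\<in>pverts G. \<not> twins G u v) \<and> degenerate_triples G"
  have "?D G \<longleftrightarrow> exceptional G \<or> exceptional ?C"
  proof
    assume "?D G"
    then show "exceptional G \<or> exceptional ?C"
      using exceptional_of_degenerate_triples[OF G] by blast
  next
    have "?D ?C \<longleftrightarrow> ?D G" by (simp add: twins_complement degenerate_triples_complement)
    then show "exceptional G \<or> exceptional ?C \<Longrightarrow> ?D G"
      using degenerate_triples_if_exceptional[OF G True]
        degenerate_triples_if_exceptional[OF pair_graph_complement[OF G]] True by auto
  qed
  then show ?thesis
    using adj_dim_eq_order_minus_two_iff[OF pair_graphD(1)[OF G] True] by simp
next
  case False
  then have "\<not> exceptional G" "\<not> exceptional (graph_complement G)"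
    using two card_ge_2_if_exceptional[OF G]
      card_ge_2_if_exceptional[OF pair_graph_complement[OF G]] by auto
  then show ?thesis using False two by simp
qed

theorem theorem2p4:
  fixes G :: "'a pair_pre_digraph" and n :: nat
  assumes "pair_graph G"
    and "card (pverts G) = n"
    and "n \<noteq> 2"
  shows "int (adj_dim G) = int n - 2 \<longleftrightarrow>
    (\<exists>H \<in> {G, graph_complement G}.
        digraph_iso (with_proj H) (with_proj (path_graph 4))
      \<or> (\<exists>s t. s \<ge> 1 \<and> t \<ge> 1 \<and> complete_bipartite_digraph s t (with_proj H))
      \<or> (\<exists>s t. s \<ge> 1 \<and> t \<ge> 2 \<and> digraph_iso (with_proj H)
            (with_proj (graph_join (complete_graph s) (graph_complement (complete_graph t)))))
      \<or> (\<exists>s t. s \<ge> 1 \<and> t \<ge> 1 \<and> digraph_iso (with_proj H)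
            (with_proj (graph_join (complete_graph s)
              (graph_union (complete_graph t) (complete_graph 1))))))"
proof -
  note C = pair_graph_complement[OF assms(1)]
  have "int (adj_dim G) = int n - 2 \<longleftrightarrow> (\<exists>H \<in> {G, graph_complement G}. exceptional H)"
    using adj_dim_eq_iff_exceptional[OF assms(1)] assms(2,3) by simp
  \<comment> \<open>The existential over \<open>G\<close> and its complement becomes a disjunction,
    in which each family is replaced by its intrinsic description.\<close>
  then show ?thesis
    unfolding exceptional_def bex_simps
      iso_path4_iff[OF assms(1)] iso_path4_iff[OF C] biclique_iff[OF assms(1)] biclique_iff[OF C]
      iso_complete_split_iff[OF assms(1)] iso_complete_split_iff[OF C]
      iso_clique_with_satellite_iff[OF assms(1)] iso_clique_with_satellite_iff[OF C] .
qed

end
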